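(* Assume that $z,w\in A_1$, $[z,w]=1$, and either $z$ or $w$ is in $D_{\ge 0}$. Then $z$ and $w$ generate $A_1$ (as a $K$-algebra).
   Context: $K$ is a field of characteristic $0$. $A_1$ is the first Weyl algebra over $K$, i.e. the associative unital $K$-algebra generated by $p,q$ subject to $pq-qp=1$; the elements $p^iq^j$ ($i,j\in\mathbb{Z}_{\ge0}$) form a $K$-basis. $[a,b]=ab-ba$. For $t\in\mathbb{Z}$, $D_t=\mathrm{Span}_K\{p^iq^s : i,s\ge 0,\ s-i=t\}$, and $D_{\ge 0}=\bigoplus_{t\ge 0}D_t$. *)

theory Defs
  imports
    Complex_Main
    "HOL-Library.Poly_Mapping"
    "HOL-Computational_Algebra.Polynomial"
begin

text \<open>
  The first Weyl algebra is built as its presentation: the free unital algebra on two generators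
  modulo the two-sided ideal generated by the single relation. The free algebra is the monoid
  algebra of the monoid of words, obtained from \<^type>\<open>poly_mapping\<close> with its convolution product.
  Since that product is indexed by an additively written monoid, concatenation of words is
  written \<open>+\<close>.
\<close>

datatype weyl_letter = LetterP | LetterQ

datatype weyl_word = Word "weyl_letter list"

instantiation weyl_word :: monoid_add
begin

definition zero_weyl_word :: weyl_word
  where "0 = Word []"

fun plus_weyl_word :: "weyl_word \<Rightarrow> weyl_word \<Rightarrow> weyl_word"
  where "Word u + Word v = Word (u @ v)"

instance
proof
  fix a b c :: weyl_word
  show "a + b + c = a + (b + c)" by (cases a; cases b; cases c) simp
  show "0 + a = a" "a + 0 = a" by (cases a; simp add: zero_weyl_word_def)+
qed

end

type_synonym 'k free_weyl = "weyl_word \<Rightarrow>\<^sub>0 'k"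

definition free_gen :: "weyl_letter \<Rightarrow> 'k::field free_weyl"
  where "free_gen l = Poly_Mapping.single (Word [l]) 1"

inductive_set weyl_ideal :: "'k::field free_weyl set"
  where
    rel: "free_gen LetterP * free_gen LetterQ - free_gen LetterQ * free_gen LetterP - 1 \<in> weyl_ideal"
  | zero: "0 \<in> weyl_ideal"
  | add: "a \<in> weyl_ideal \<Longrightarrow> b \<in> weyl_ideal \<Longrightarrow> a + b \<in> weyl_ideal"
  | mult_left: "a \<in> weyl_ideal \<Longrightarrow> c * a \<in> weyl_ideal"
  | mult_right: "a \<in> weyl_ideal \<Longrightarrow> a * c \<in> weyl_ideal"

lemma weyl_ideal_uminus: "a \<in> weyl_ideal \<Longrightarrow> - a \<in> weyl_ideal"
  using weyl_ideal.mult_left[of a "- 1"] by simp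

lemma weyl_ideal_diff: "a \<in> weyl_ideal \<Longrightarrow> b \<in> weyl_ideal \<Longrightarrow> a - b \<in> weyl_ideal"
  using weyl_ideal.add[of a "- b"] weyl_ideal_uminus[of b] by simp

text \<open>
  The class \<^class>\<open>ring_1\<close> includes \<open>0 \<noteq> 1\<close>, so the instance below needs the ideal to be proper.
  This follows from the action on polynomials with \<open>p\<close> acting as the derivative and \<open>q\<close> as
  multiplication by the variable.
\<close>

fun letter_act :: "weyl_letter \<Rightarrow> 'k::field poly \<Rightarrow> 'k poly"
  where
    "letter_act LetterP v = pderiv v"
  | "letter_act LetterQ v = [:0, 1:] * v"

fun word_act :: "weyl_word \<Rightarrow> 'k::field poly \<Rightarrow> 'k poly"
  where "word_act (Word u) v = foldr letter_act u v"

definition free_act :: "'k::field free_weyl \<Rightarrow> 'k poly \<Rightarrow> 'k poly"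
  where "free_act f v = (\<Sum>w\<in>Poly_Mapping.keys f. smult (Poly_Mapping.lookup f w) (word_act w v))"

lemma letter_act_add: "letter_act l (u + v) = letter_act l u + letter_act l v"
  by (cases l) (simp_all add: pderiv_add algebra_simps)

lemma letter_act_smult: "letter_act l (smult c v) = smult c (letter_act l v)"
  by (cases l) (simp_all add: pderiv_smult)

lemma word_act_add: "word_act w (u + v) = word_act w u + word_act w v"
proof (cases w)
  case (Word x)
  have "foldr letter_act x (u + v) = foldr letter_act x u + foldr letter_act x v"
    by (induction x) (simp_all add: letter_act_add)
  then show ?thesis by (simp add: Word)
qed

lemma word_act_smult: "word_act w (smult c v) = smult c (word_act w v)"
proof (cases w)
  case (Word x)
  have "foldr letter_act x (smult c v) = smult c (foldr letter_act x v)"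
    by (induction x) (simp_all add: letter_act_smult)
  then show ?thesis by (simp add: Word)
qed

lemma word_act_plus: "word_act (a + b) v = word_act a (word_act b v)"
  by (cases a; cases b) simp

lemma free_act_zero [simp]: "free_act 0 v = 0"
  by (simp add: free_act_def)

lemma free_act_add: "free_act (f + g) v = free_act f v + free_act g v"
  unfolding free_act_def by (rule setsum_keys_plus_distrib) (simp_all add: smult_add_left)

lemma free_act_uminus: "free_act (- f) v = - free_act f v"
  using free_act_add[of f "- f" v] by (simp add: eq_neg_iff_add_eq_0 add.commute)

lemma free_act_diff: "free_act (f - g) v = free_act f v - free_act g v"
  using free_act_add[of f "- g" v] by (simp add: free_act_uminus)

lemma free_act_single: "free_act (Poly_Mapping.single w c) v = smult c (word_act w v)"
  by (cases "c = 0") (simp_all add: free_act_def)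

lemma free_act_one: "free_act 1 v = v"
proof -
  have "free_act (Poly_Mapping.single 0 1) v = v"
    by (simp only: free_act_single) (simp add: zero_weyl_word_def)
  then show ?thesis by simp
qed

lemma free_act_vec_add: "free_act f (u + v) = free_act f u + free_act f v"
  by (simp add: free_act_def word_act_add smult_add_right sum.distrib)

lemma free_act_vec_smult: "free_act f (smult c v) = smult c (free_act f v)"
proof -
  have "smult c (sum h A) = (\<Sum>x\<in>A. smult c (h x))" for h :: "weyl_word \<Rightarrow> 'a poly" and A
    by (induction A rule: infinite_finite_induct) (simp_all add: smult_add_right)
  then show ?thesis
    by (simp add: free_act_def word_act_smult mult.commute)
qed

lemma poly_mapping_sum_induct [case_names zero single_add]:
  assumes "P 0"
    and "\<And>w c f. P f \<Longrightarrow> P (Poly_Mapping.single w c + f)"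
  shows "P (f :: 'a \<Rightarrow>\<^sub>0 'b::comm_monoid_add)"
proof (induction f rule: update_induct)
  case (update f a b)
  have "Poly_Mapping.update a b f = Poly_Mapping.single a b + f"
    using update(1)
    by (intro poly_mapping_eqI)
      (auto simp: lookup_update lookup_add lookup_single in_keys_iff when_def)
  then show ?case using assms(2) update by simp
qed (rule assms(1))

lemma free_act_mult: "free_act (f * g) v = free_act f (free_act g v)"
proof -
  have single: "free_act (Poly_Mapping.single w c * g) v
      = free_act (Poly_Mapping.single w c) (free_act g v)" for w c
  proof (induction g rule: poly_mapping_sum_induct)
    case zero
    show ?case
      using free_act_vec_smult[of "Poly_Mapping.single w c" 0 0] by simp
  next
    case (single_add w' c' g)
    then show ?case
      by (simp add: distrib_left free_act_add free_act_vec_add mult_single free_act_single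
          word_act_plus word_act_smult)
  qed
  show ?thesis
    by (induction f rule: poly_mapping_sum_induct)
      (simp_all add: single distrib_right free_act_add)
qed

lemma free_act_weyl_ideal: "a \<in> weyl_ideal \<Longrightarrow> free_act a v = 0"
proof (induction arbitrary: v rule: weyl_ideal.induct)
  case rel
  show ?case
    by (simp add: free_act_diff free_act_mult free_act_one free_gen_def free_act_single pderiv_pCons)
next
  case (mult_left a c)
  then show ?case
    using free_act_vec_smult[of c 0 0] by (simp add: free_act_mult)
qed (simp_all add: free_act_add free_act_mult)

lemma one_notin_weyl_ideal: "1 \<notin> weyl_ideal"
  using free_act_weyl_ideal[of 1 1] by (auto simp: free_act_one)

definition weyl_cong :: "'k::field free_weyl \<Rightarrow> 'k free_weyl \<Rightarrow> bool"
  where "weyl_cong a b \<longleftrightarrow> a - b \<in> weyl_ideal"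

quotient_type (overloaded) 'k weyl = "'k::field free_weyl" / weyl_cong
proof (rule equivpI)
  show "reflp weyl_cong"
    by (auto intro!: reflpI simp: weyl_cong_def weyl_ideal.zero)
  show "symp weyl_cong"
    using weyl_ideal_uminus by (fastforce intro!: sympI simp: weyl_cong_def)
  show "transp weyl_cong"
    using weyl_ideal.add by (fastforce intro!: transpI simp: weyl_cong_def)
qed

instantiation weyl :: (field) ring_1
begin

lift_definition zero_weyl :: "'k::field weyl" is 0 .

lift_definition one_weyl :: "'k::field weyl" is 1 .

lift_definition plus_weyl :: "'k::field weyl \<Rightarrow> 'k weyl \<Rightarrow> 'k weyl" is "(+)"
  using weyl_ideal.add by (fastforce simp: weyl_cong_def algebra_simps)

lift_definition uminus_weyl :: "'k::field weyl \<Rightarrow> 'k weyl" is uminus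
  using weyl_ideal_uminus by (fastforce simp: weyl_cong_def)

lift_definition minus_weyl :: "'k::field weyl \<Rightarrow> 'k weyl \<Rightarrow> 'k weyl" is "(-)"
  using weyl_ideal_diff by (fastforce simp: weyl_cong_def algebra_simps)

lift_definition times_weyl :: "'k::field weyl \<Rightarrow> 'k weyl \<Rightarrow> 'k weyl" is "(*)"
proof -
  fix a a' b b' :: "'k free_weyl"
  assume "weyl_cong a a'" "weyl_cong b b'"
  then have "(a - a') * b + a' * (b - b') \<in> weyl_ideal"
    by (auto simp: weyl_cong_def intro: weyl_ideal.intros)
  then show "weyl_cong (a * b) (a' * b')"
    by (simp add: weyl_cong_def algebra_simps)
qed

instance
proof
  show "(0 :: 'a weyl) \<noteq> 1"
    by transfer (use weyl_ideal_uminus[of "- 1"] one_notin_weyl_ideal in \<open>auto simp: weyl_cong_def\<close>)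
qed (transfer; simp add: weyl_cong_def weyl_ideal.zero algebra_simps)+

end

lift_definition weyl_p :: "'k::field weyl" is "free_gen LetterP" .

lift_definition weyl_q :: "'k::field weyl" is "free_gen LetterQ" .

lift_definition weyl_scalar :: "'k::field \<Rightarrow> 'k weyl" is "Poly_Mapping.single 0" .

definition weyl_scale :: "'k::field \<Rightarrow> 'k weyl \<Rightarrow> 'k weyl"
  where "weyl_scale c a = weyl_scalar c * a"

lemma weyl_scalar_add: "weyl_scalar (c + d) = weyl_scalar c + weyl_scalar d"
  by transfer (simp add: weyl_cong_def single_add weyl_ideal.zero)

lemma weyl_scalar_mult: "weyl_scalar (c * d) = weyl_scalar c * weyl_scalar d"
  by transfer (simp add: weyl_cong_def mult_single weyl_ideal.zero)

lemma weyl_scalar_one: "weyl_scalar 1 = 1"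
  by transfer (simp add: weyl_cong_def weyl_ideal.zero)

global_interpretation weyl: vector_space weyl_scale
  by unfold_locales
    (simp_all add: weyl_scale_def weyl_scalar_add weyl_scalar_mult weyl_scalar_one
      distrib_left distrib_right mult.assoc)

lemma weyl_relation: "weyl_p * weyl_q - weyl_q * weyl_p = (1 :: 'k::field weyl)"
  by transfer (simp add: weyl_cong_def weyl_ideal.rel)

definition commutator :: "'a::ring \<Rightarrow> 'a \<Rightarrow> 'a"
  where "commutator a b = a * b - b * a"

definition weyl_D :: "int \<Rightarrow> 'k::field weyl set"
  where "weyl_D t = weyl.span {weyl_p ^ i * weyl_q ^ s | i s. int s - int i = t}"

text \<open>
  The sum of the subspaces \<open>D\<^sub>t\<close> is the span of their union; it is direct because the elements
  \<open>p\<^sup>i q\<^sup>s\<close> form a basis.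
\<close>

definition weyl_D_nonneg :: "'k::field weyl set"
  where "weyl_D_nonneg = weyl.span (\<Union>t\<in>{0..}. weyl_D t)"

definition weyl_subalgebra :: "'k::field weyl set \<Rightarrow> bool"
  where "weyl_subalgebra B \<longleftrightarrow>
    weyl.subspace B \<and> 1 \<in> B \<and> (\<forall>a\<in>B. \<forall>b\<in>B. a * b \<in> B)"

end

theory Submission
  imports Defs
begin

text \<open>
  Let \<open>p\<close> act on polynomials in \<open>q\<close> as the derivative and \<open>q\<close> as multiplication by the variable.
  An element \<open>x\<close> then acts by \<open>x q\<^sup>n = (\<Sum>t. x\<^sub>t(n) q\<^sup>n\<^sup>+\<^sup>t)\<close> with polynomials \<open>x\<^sub>t\<close> in \<open>n\<close>, its
  diagonals; they correspond to the components of \<open>x\<close> in the subspaces \<open>D\<^sub>t\<close>. In characteristic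
  \<open>0\<close> the diagonals determine \<open>x\<close>, and the element lies in \<open>D\<^sub>\<ge>\<^sub>0\<close> only if its diagonals
  of negative index vanish. Multiplication becomes a convolution twisted by the shifts
  \<open>X \<mapsto> X + b\<close>. Consequently, if \<open>x\<^sub>a\<close> and \<open>y\<^sub>b\<close> have degrees \<open>d\<close> and \<open>e\<close>, their contribution to
  \<open>[x, y]\<close> has degree at most \<open>d + e - 1\<close>, and the coefficient in that degree is \<open>b d - a e\<close> times
  the product of the leading coefficients (\<open>coeff_diag_bracket\<close>). This determinant is the shadow of
  the Poisson bracket, and the whole proof consists of looking at extreme points of the Newton
  polygons formed by the points \<open>(a, d)\<close> and \<open>(b, e)\<close>, where only one pair contributes.

  Exchanging the two elements up to a sign, one may assume \<open>z \<in> D\<^sub>\<ge>\<^sub>0\<close>. Let \<open>b\<close> be the least index of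
  a diagonal of \<open>w\<close>. Comparing components of lowest index in \<open>[z, w] = 1\<close> forces \<open>b < 0\<close>, then forces \<open>z\<^sub>0\<close> to be
  constant. For the least \<open>a > 0\<close> with \<open>z\<^sub>a \<noteq> 0\<close> one has \<open>b d - a e < 0\<close>, because a diagonal of
  index \<open>b < 0\<close> has the \<open>-b\<close> roots \<open>0, \<dots>, -b - 1\<close>. So the lowest bracket does not vanish, it must
  be the diagonal of \<open>1\<close>, and comparing indices and degrees leaves only \<open>z\<^sub>1 = \<alpha>\<close> and \<open>w\<^sub>-\<^sub>1 = \<beta> X\<close> with no lower diagonals (\<open>lowest_diagonals\<close>). In
  other words \<open>z\<close> starts with \<open>\<alpha> q\<close> and \<open>w\<close> with \<open>\<beta> p\<close>.

  Now rotate a supporting line around the points \<open>(1, 0)\<close> of \<open>z\<close> and \<open>(-1, 1)\<close> of \<open>w\<close> until it first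
  meets another point: take the least slope \<open>\<nu> \<ge> 0\<close> such that \<open>d \<le> \<nu> (a - 1)\<close> and
  \<open>e - 1 \<le> \<nu> (b + 1)\<close> throughout. At the rightmost points on the two supporting lines the
  determinant is \<open>-(\<nu> (a + b) + a) < 0\<close>, so \<open>[z, w]\<close> has a nonzero diagonal of index \<open>a + b\<close>. If
  \<open>z\<close> had a diagonal of index at least \<open>2\<close>, then \<open>a + b > 0\<close>, contradicting \<open>[z, w] = 1\<close>
  (\<open>higher_diagonals_vanish\<close>). Hence \<open>z = \<gamma> + \<alpha> q\<close>. The relation with \<open>w\<close> now makes every
  diagonal of \<open>w\<close> of nonnegative index constant, that is, \<open>w = \<beta> p + f(q)\<close> for a polynomial \<open>f\<close>,
  and such a pair obviously generates.
\<close>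

section \<open>The diagonals of an element of the Weyl algebra\<close>

text \<open>
  A family of polynomials \<open>m\<^sub>t\<close> stands for the operator \<open>q\<^sup>n \<mapsto> (\<Sum>t. m\<^sub>t(n) q\<^sup>n\<^sup>+\<^sup>t)\<close>, and a letter acts on
  families by composing this operator with the letter on its left. Differentiating \<open>q\<close> to the power
  \<open>n + t + 1\<close> is the origin of the factor \<open>X + t + 1\<close>.
\<close>

fun letter_diag :: "weyl_letter \<Rightarrow> (int \<Rightarrow> 'k::field poly) \<Rightarrow> int \<Rightarrow> 'k poly"
  where
    "letter_diag LetterP m t = [:of_int (t + 1), 1:] * m (t + 1)"
  | "letter_diag LetterQ m t = m (t - 1)"

fun word_diag :: "weyl_word \<Rightarrow> (int \<Rightarrow> 'k::field poly) \<Rightarrow> int \<Rightarrow> 'k poly"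
  where "word_diag (Word u) m = foldr letter_diag u m"

definition free_diag :: "'k::field free_weyl \<Rightarrow> (int \<Rightarrow> 'k poly) \<Rightarrow> int \<Rightarrow> 'k poly"
  where "free_diag f m t =
    (\<Sum>w\<in>Poly_Mapping.keys f. smult (Poly_Mapping.lookup f w) (word_diag w m t))"

lemma word_diag_add: "word_diag w (\<lambda>t. m t + n t) = (\<lambda>t. word_diag w m t + word_diag w n t)"
proof (cases w)
  case (Word x)
  have letter: "letter_diag l (\<lambda>t. m t + n t) = (\<lambda>t. letter_diag l m t + letter_diag l n t)"
    for l and m n :: "int \<Rightarrow> 'a poly"
    by (cases l) (auto simp: algebra_simps)
  have "foldr letter_diag x (\<lambda>t. m t + n t) = (\<lambda>t. foldr letter_diag x m t + foldr letter_diag x n t)"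
    by (induction x) (simp_all add: letter)
  then show ?thesis by (simp add: Word)
qed

lemma word_diag_smult: "word_diag w (\<lambda>t. smult c (m t)) = (\<lambda>t. smult c (word_diag w m t))"
proof (cases w)
  case (Word x)
  have letter: "letter_diag l (\<lambda>t. smult c (m t)) = (\<lambda>t. smult c (letter_diag l m t))"
    for l and m :: "int \<Rightarrow> 'a poly"
    by (cases l) (auto simp: mult_smult_right simp del: mult_pCons_left)
  have "foldr letter_diag x (\<lambda>t. smult c (m t)) = (\<lambda>t. smult c (foldr letter_diag x m t))"
    by (induction x) (simp_all add: letter)
  then show ?thesis by (simp add: Word)
qed

lemma word_diag_plus: "word_diag (a + b) m = word_diag a (word_diag b m)"
  by (cases a; cases b) simp

lemma free_diag_zero: "free_diag 0 m = (\<lambda>t. 0)"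
  by (simp add: free_diag_def fun_eq_iff)

lemma free_diag_add: "free_diag (f + g) m = (\<lambda>t. free_diag f m t + free_diag g m t)"
  unfolding free_diag_def fun_eq_iff
  by (intro allI setsum_keys_plus_distrib) (simp_all add: smult_add_left)

lemma free_diag_diff: "free_diag (f - g) m = (\<lambda>t. free_diag f m t - free_diag g m t)"
  using free_diag_add[of "f - g" g m] by (simp add: fun_eq_iff)

lemma free_diag_single: "free_diag (Poly_Mapping.single w c) m = (\<lambda>t. smult c (word_diag w m t))"
  by (cases "c = 0") (simp_all add: free_diag_def fun_eq_iff)

lemma free_diag_scalar: "free_diag (Poly_Mapping.single 0 c) m = (\<lambda>t. smult c (m t))"
  by (simp only: free_diag_single) (simp add: zero_weyl_word_def)

lemma free_diag_one: "free_diag 1 m = m"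
  using free_diag_scalar[of 1 m] by simp

lemma free_diag_gen: "free_diag (free_gen l) m = letter_diag l m"
  by (simp add: free_gen_def free_diag_single)

lemma free_diag_vec_zero: "free_diag f (\<lambda>t. 0) = (\<lambda>t. 0)"
proof -
  have "word_diag w (\<lambda>t. 0) = (\<lambda>t. 0 :: 'a poly)" for w
    using word_diag_smult[of w 0 "\<lambda>t. 0"] by simp
  then show ?thesis by (simp add: free_diag_def fun_eq_iff)
qed

lemma free_diag_vec_add:
  "free_diag f (\<lambda>t. m t + n t) = (\<lambda>t. free_diag f m t + free_diag f n t)"
  by (simp add: free_diag_def word_diag_add smult_add_right sum.distrib fun_eq_iff)

lemma free_diag_mult: "free_diag (f * g) m = free_diag f (free_diag g m)"
proof -
  have single: "free_diag (Poly_Mapping.single w c * g) m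
      = free_diag (Poly_Mapping.single w c) (free_diag g m)" for w c
    by (induction g rule: poly_mapping_sum_induct)
      (simp_all add: distrib_left free_diag_zero free_diag_vec_zero free_diag_add
        free_diag_vec_add mult_single free_diag_single word_diag_plus word_diag_smult)
  show ?thesis
    by (induction f rule: poly_mapping_sum_induct)
      (simp_all add: single distrib_right free_diag_add free_diag_zero)
qed

lemma free_diag_weyl_ideal: "a \<in> weyl_ideal \<Longrightarrow> free_diag a m = (\<lambda>t. 0)"
proof (induction arbitrary: m rule: weyl_ideal.induct)
  case rel
  show ?case
    by (simp add: free_diag_diff free_diag_mult free_diag_one free_diag_gen smult_add_left
        fun_eq_iff)
qed (simp_all add: free_diag_add free_diag_mult free_diag_vec_zero free_diag_zero)

text \<open>
  Diagonal \<open>t\<close> of \<open>x\<close>. The family inserted at the start is that of the identity operator, and the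
  action of the free algebra on it descends to the quotient.
\<close>

lift_definition diag :: "'k::field weyl \<Rightarrow> int \<Rightarrow> 'k poly"
  is "\<lambda>f. free_diag f (\<lambda>t. if t = 0 then 1 else 0)"
proof -
  fix f g :: "'k free_weyl"
  assume "weyl_cong f g"
  then show "free_diag f (\<lambda>t. if t = 0 then 1 else 0) = free_diag g (\<lambda>t. if t = 0 then 1 else 0)"
    using free_diag_weyl_ideal[of "f - g"]
    by (simp add: weyl_cong_def free_diag_diff fun_eq_iff)
qed

lemma diag_add: "diag (x + y) t = diag x t + diag y t"
  by transfer (simp add: free_diag_add)

lemma diag_zero: "diag 0 t = 0"
  by transfer (simp add: free_diag_zero)

lemma diag_one: "diag 1 t = (if t = 0 then 1 else 0)"
  by transfer (simp add: free_diag_one)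

lemma diag_diff: "diag (x - y) t = diag x t - diag y t"
  by transfer (simp add: free_diag_diff)

lemma diag_scale: "diag (weyl_scale c x) t = smult c (diag x t)"
  unfolding weyl_scale_def by transfer (simp add: free_diag_mult free_diag_scalar)

lemma diag_sum: "diag (sum f A) t = (\<Sum>x\<in>A. diag (f x) t)"
  by (induction A rule: infinite_finite_induct) (simp_all add: diag_zero diag_add)

lemma diag_p_mult: "diag (weyl_p * x) t = [:of_int (t + 1), 1:] * diag x (t + 1)"
  by transfer (simp add: free_diag_mult free_diag_gen)

lemma diag_q_mult: "diag (weyl_q * x) t = diag x (t - 1)"
  by transfer (simp add: free_diag_mult free_diag_gen)

lemma diag_q_power_mult: "diag (weyl_q ^ i * x) t = diag x (t - int i)"
  by (induction i arbitrary: t) (simp_all add: mult.assoc diag_q_mult algebra_simps)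

lemma diag_q_power: "diag (weyl_q ^ i) t = (if t = int i then 1 else 0)"
  using diag_q_power_mult[of i 1 t] by (simp add: diag_one)

lemma diag_p: "diag weyl_p t = (if t = -1 then [:0, 1:] else 0)"
  using diag_p_mult[of 1 t] by (auto simp: diag_one)

text \<open>
  The statements about diagonals are proved by building elements from scalars by left
  multiplication with the generators, since this is how the diagonals are computed.
\<close>

lemma weyl_induct [case_names scale_one add p_mult q_mult]:
  fixes x :: "'k::field weyl"
  assumes scale_one: "\<And>c. P (weyl_scale c 1)"
    and add: "\<And>x y. P x \<Longrightarrow> P y \<Longrightarrow> P (x + y)"
    and p_mult: "\<And>x. P x \<Longrightarrow> P (weyl_p * x)"
    and q_mult: "\<And>x. P x \<Longrightarrow> P (weyl_q * x)"
  shows "P x"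
proof -
  have word: "P (abs_weyl (Poly_Mapping.single (Word u) c))" for u c
  proof (induction u)
    case Nil
    then show ?case
      using scale_one[of c] by (simp add: weyl_scale_def weyl_scalar.abs_eq zero_weyl_word_def)
  next
    case (Cons l u)
    have "abs_weyl (Poly_Mapping.single (Word (l # u)) c)
        = abs_weyl (free_gen l) * abs_weyl (Poly_Mapping.single (Word u) c)"
      by (simp add: times_weyl.abs_eq free_gen_def mult_single)
    then show ?case
      using Cons p_mult q_mult by (cases l) (simp_all add: weyl_p_def weyl_q_def)
  qed
  have "P (abs_weyl f)" for f
  proof (induction f rule: poly_mapping_sum_induct)
    case zero
    show ?case using word[of "[]" 0] by simp
  next
    case (single_add w c f)
    then show ?case
      using add[OF word single_add] by (cases w) (simp add: plus_weyl.abs_eq)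
  qed
  then show ?thesis by (induction x) (auto intro: Quotient3_abs_rep)
qed

lemma finite_diag: "finite {t. diag x t \<noteq> 0}"
proof (induction x rule: weyl_induct)
  case (scale_one c)
  show ?case by (rule finite_subset[of _ "{0}"]) (auto simp: diag_scale diag_one)
next
  case (add x y)
  then show ?case
    by (rule finite_subset[rotated, OF finite_UnI]) (auto simp: diag_add)
next
  case (p_mult x)
  show ?case
    by (rule finite_subset[OF _ finite_vimageI[OF p_mult, of "\<lambda>t. t + 1"]])
      (auto simp: diag_p_mult inj_def)
next
  case (q_mult x)
  show ?case
    by (rule finite_subset[OF _ finite_vimageI[OF q_mult, of "\<lambda>t. t - 1"]])
      (auto simp: diag_q_mult inj_def)
qed

text \<open>
  The operator maps polynomials to polynomials, so the coefficient of a negative power of \<open>q\<close> in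
  the image of \<open>q\<^sup>n\<close> must vanish.
\<close>

lemma diag_root: "int n + t < 0 \<Longrightarrow> poly (diag x t) (of_nat n) = 0"
proof (induction x arbitrary: t rule: weyl_induct)
  case (p_mult x)
  show ?case
  proof (cases "int n + t = - 1")
    case True
    then have "t = - 1 - int n" by simp
    then show ?thesis by (simp add: diag_p_mult)
  next
    case False
    then show ?thesis using p_mult by (simp add: diag_p_mult del: mult_pCons_left)
  qed
qed (simp_all add: diag_scale diag_one diag_add diag_q_mult)

lemma diag_negative_degree:
  fixes x :: "'k::field_char_0 weyl"
  assumes "t < 0" "diag x t \<noteq> 0"
  shows "- t \<le> int (degree (diag x t))"
proof -
  have "card (of_nat ` {..<nat (- t)} :: 'k set) \<le> card {a. poly (diag x t) a = 0}"
    using assms by (intro card_mono poly_roots_finite) (auto intro!: diag_root)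
  also have "\<dots> \<le> degree (diag x t)"
    using assms by (intro card_poly_roots_bound)
  finally show ?thesis
    by (simp add: card_image inj_on_def)
qed

lemma diag_nonneg:
  assumes "x \<in> weyl_D_nonneg" "t < 0"
  shows "diag x t = 0"
proof -
  have p_power: "diag y (t + int i) = 0 \<Longrightarrow> diag (weyl_p ^ i * y) t = 0"
    for y :: "'a weyl" and i t
    by (induction i arbitrary: t) (simp_all add: mult.assoc diag_p_mult algebra_simps)
  have D: "diag y t = 0" if "y \<in> weyl_D u" "u \<ge> 0" for y :: "'a weyl" and u
    using that(1) unfolding weyl_D_def
  proof (induction rule: weyl.span_induct_alt)
    case (step c x y)
    then show ?case
      using assms(2) that(2) by (auto simp: diag_add diag_scale diag_q_power intro!: p_power)
  qed (simp add: diag_zero)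
  show ?thesis
    using assms(1) unfolding weyl_D_nonneg_def
  proof (induction rule: weyl.span_induct_alt)
    case (step c x y)
    then show ?case
      using D by (auto simp: diag_add diag_scale)
  qed (simp add: diag_zero)
qed

section \<open>Products and commutators\<close>

abbreviation shift_poly :: "int \<Rightarrow> 'k::field poly \<Rightarrow> 'k poly"
  where "shift_poly b P \<equiv> pcompose P [:of_int b, 1:]"

text \<open>
  Composition of operators: \<open>y\<close> sends \<open>q\<^sup>n\<close> to multiples of \<open>q\<^sup>n\<^sup>+\<^sup>b\<close>, so the diagonals of \<open>x\<close> are to be
  evaluated at \<open>n + b\<close>. The summation set is left open so that sums over different supports can
  be compared.
\<close>

lemma diag_mult:
  assumes "finite S" "\<And>b. b \<notin> S \<Longrightarrow> diag y b = 0"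
  shows "diag (x * y) t = (\<Sum>b\<in>S. shift_poly b (diag x (t - b)) * diag y b)"
proof (induction x arbitrary: t rule: weyl_induct)
  case (scale_one c)
  have "(\<Sum>b\<in>S. shift_poly b (diag (weyl_scale c 1) (t - b)) * diag y b)
      = (\<Sum>b\<in>S. if b = t then smult c (diag y t) else 0)"
    by (intro sum.cong) (auto simp: diag_scale diag_one pcompose_smult pcompose_1)
  also have "\<dots> = smult c (diag y t)"
    using assms by simp
  finally show ?case
    by (simp add: weyl_scale_def flip: diag_scale)
next
  case (add x x')
  then show ?case
    by (simp add: distrib_right diag_add pcompose_add sum.distrib)
next
  case (p_mult x)
  have "shift_poly b (diag (weyl_p * x) (t - b)) * diag y b
      = [:of_int (t + 1), 1:] * (shift_poly b (diag x (t + 1 - b)) * diag y b)" for b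
  proof -
    have "shift_poly b [:of_int (t - b + 1), 1:] = [:of_int (t + 1), 1 :: 'a:]"
      by (simp add: pcompose_pCons)
    then show ?thesis
      by (simp only: diag_p_mult pcompose_mult mult.assoc diff_add_eq)
  qed
  then show ?case
    by (simp only: mult.assoc diag_p_mult p_mult sum_distrib_left)
next
  case (q_mult x)
  then show ?case
    by (simp add: mult.assoc diag_q_mult algebra_simps)
qed

text \<open>
  The commutator of the operators that have the single diagonals \<open>P\<close> in position \<open>a\<close> and \<open>Q\<close> in
  position \<open>b\<close>; it sits in position \<open>a + b\<close>.
\<close>

definition diag_bracket :: "int \<Rightarrow> int \<Rightarrow> 'k::field poly \<Rightarrow> 'k poly \<Rightarrow> 'k poly"
  where "diag_bracket a b P Q = shift_poly b P * Q - shift_poly a Q * P"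

lemma diag_commutator:
  assumes S: "finite S" "\<And>a. a \<notin> S \<Longrightarrow> diag x a = 0"
  shows "diag (commutator x y) t = (\<Sum>a\<in>S. diag_bracket a (t - a) (diag x a) (diag y (t - a)))"
proof -
  \<comment> \<open>A common index set for both products: all \<open>a\<close> for which one of the two factors is nonzero.\<close>
  define T where "T = S \<union> (\<lambda>b. t - b) ` {b. diag y b \<noteq> 0}"
  have T: "finite T" unfolding T_def using S finite_diag[of y] by (intro finite_UnI finite_imageI)
  have "diag (x * y) t = (\<Sum>b\<in>(\<lambda>a. t - a) ` T. shift_poly b (diag x (t - b)) * diag y b)"
    using finite_diag[of y] T by (intro diag_mult) (auto simp: T_def image_Un image_image)
  also have "\<dots> = (\<Sum>a\<in>T. shift_poly (t - a) (diag x a) * diag y (t - a))"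
    by (subst sum.reindex) (auto simp: inj_on_def)
  finally have xy: "diag (x * y) t = (\<Sum>a\<in>T. shift_poly (t - a) (diag x a) * diag y (t - a))" .
  have "diag (y * x) t = (\<Sum>a\<in>T. shift_poly a (diag y (t - a)) * diag x a)"
    using T S by (intro diag_mult) (auto simp: T_def)
  with xy have "diag (commutator x y) t
      = (\<Sum>a\<in>T. diag_bracket a (t - a) (diag x a) (diag y (t - a)))"
    by (simp add: commutator_def diag_diff diag_bracket_def sum_subtractf)
  also have "\<dots> = (\<Sum>a\<in>S. diag_bracket a (t - a) (diag x a) (diag y (t - a)))"
    using S T by (intro sum.mono_neutral_right) (auto simp: T_def diag_bracket_def)
  finally show ?thesis .
qed

text \<open>
  The form in which commutators are used at an extreme point of the Newton polygons: there all
  pairs of diagonals but one fail to contribute.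
\<close>

lemma coeff_diag_commutator:
  assumes "\<And>a. a \<noteq> a0 \<Longrightarrow> coeff (diag_bracket a (t - a) (diag x a) (diag y (t - a))) n = 0"
  shows "coeff (diag (commutator x y) t) n
    = coeff (diag_bracket a0 (t - a0) (diag x a0) (diag y (t - a0))) n"
proof -
  define S where "S = insert a0 {a. diag x a \<noteq> 0}"
  have S: "finite S" "a0 \<in> S" using finite_diag[of x] by (simp_all add: S_def)
  have "(\<Sum>a\<in>S - {a0}. coeff (diag_bracket a (t - a) (diag x a) (diag y (t - a))) n) = 0"
    using assms by (intro sum.neutral) auto
  moreover have "diag (commutator x y) t
      = (\<Sum>a\<in>S. diag_bracket a (t - a) (diag x a) (diag y (t - a)))"
    using S by (intro diag_commutator) (auto simp: S_def)
  ultimately show ?thesis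
    using S by (simp add: coeff_sum sum.remove)
qed

text \<open>
  The difference operator lowers the degree and acts on leading terms as \<open>b\<close> times the derivative.
  Bounding the degree instead of fixing it lets the formula also state that the coefficient
  vanishes when the degree is smaller.
\<close>

lemma coeff_shift_poly_diff:
  "degree P \<le> Suc n \<Longrightarrow> coeff (shift_poly b P - P) n = of_int b * of_nat (Suc n) * coeff P (Suc n)"
proof (induction P arbitrary: n)
  case 0
  then show ?case by simp
next
  case (pCons c P)
  show ?case
  proof (cases "P = 0")
    case True
    then show ?thesis by (simp add: coeff_pCons split: nat.split)
  next
    case False
    then have deg: "degree P \<le> n" using pCons.prems by simp
    have "degree (shift_poly b P) = degree P" by (simp add: degree_pcompose)
    have split: "shift_poly b (pCons c P) - pCons c P
        = smult (of_int b) P + pCons 0 (shift_poly b P - P) + smult (of_int b) (shift_poly b P - P)"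
      by (rule poly_eqI) (simp add: pcompose_pCons coeff_pCons algebra_simps split: nat.split)
    have "coeff (shift_poly b P - P) n = 0"
      using pCons.IH[of n] deg by (simp add: coeff_eq_0)
    then show ?thesis
    proof (cases n)
      case (Suc k)
      then show ?thesis
        using pCons.IH[of k] deg \<open>coeff (shift_poly b P - P) n = 0\<close>
        unfolding split by (simp add: algebra_simps)
    qed (simp add: split)
  qed
qed


lemma coeff_mult_of_degree_le:
  assumes "degree P \<le> d" "degree Q \<le> e"
  shows "coeff (P * Q) (d + e) = coeff P d * coeff Q e"
proof -
  have "coeff (P * Q) (d + e) = (\<Sum>i\<le>d + e. if i = d then coeff P d * coeff Q e else 0)"
    unfolding coeff_mult
  proof (intro sum.cong refl)
    fix i assume "i \<in> {..d + e}"
    moreover have "coeff P i = 0 \<or> coeff Q (d + e - i) = 0" if "i \<noteq> d" "i \<le> d + e"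
      using assms that by (cases "i < d") (auto intro!: coeff_eq_0)
    ultimately show "coeff P i * coeff Q (d + e - i) = (if i = d then coeff P d * coeff Q e else 0)"
      by auto
  qed
  then show ?thesis by simp
qed

lemma degree_shift_poly_diff: "degree P \<le> Suc n \<Longrightarrow> degree (shift_poly b P - P) \<le> n"
  by (rule degree_le) (auto simp: coeff_shift_poly_diff coeff_eq_0 simp del: coeff_diff)

lemma coeff_shift_poly_diff_mult:
  assumes "degree P \<le> d" "degree Q \<le> e" "Suc n = d + e"
  shows "coeff ((shift_poly b P - P) * Q) n = of_int b * of_nat d * coeff P d * coeff Q e"
proof (cases d)
  case 0
  then obtain c where "P = [:c:]" using assms degree_eq_zeroE by blast
  with 0 show ?thesis by simp
next
  case (Suc d')
  then have "n = d' + e" using assms by simp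
  then show ?thesis
    using assms Suc
    by (simp add: coeff_mult_of_degree_le degree_shift_poly_diff coeff_shift_poly_diff
        del: coeff_diff)
qed

text \<open>
  The products \<open>P Q\<close> cancel in the commutator and leave two differences as above. As \<open>d\<close> and \<open>e\<close>
  are only upper bounds for the degrees, the same formula shows that the coefficient vanishes when
  one of the bounds is not attained.
\<close>

lemma coeff_diag_bracket:
  assumes "degree P \<le> d" "degree Q \<le> e" "Suc n = d + e"
  shows "coeff (diag_bracket a b P Q) n
    = of_int (b * int d - a * int e) * coeff P d * coeff Q e"
proof -
  have eq: "diag_bracket a b P Q = (shift_poly b P - P) * Q - (shift_poly a Q - Q) * P"
    by (simp add: diag_bracket_def algebra_simps)
  have "coeff ((shift_poly a Q - Q) * P) n = of_int a * of_nat e * coeff Q e * coeff P d"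
    using assms by (intro coeff_shift_poly_diff_mult) auto
  with coeff_shift_poly_diff_mult[OF assms, of b] show ?thesis
    unfolding eq coeff_diff[of "_ * _"] by (simp add: algebra_simps)
qed

section \<open>An element is determined by its diagonals\<close>

lemma p_mult_q_power: "weyl_p * weyl_q ^ i = weyl_q ^ i * weyl_p + of_nat i * weyl_q ^ (i - 1)"
proof (induction i)
  case 0
  then show ?case by simp
next
  case (Suc i)
  have pq: "weyl_p * weyl_q = weyl_q * weyl_p + (1 :: 'a weyl)"
    using weyl_relation by (simp add: algebra_simps)
  have "weyl_p * weyl_q ^ Suc i = weyl_q * (weyl_p * weyl_q ^ i) + (weyl_q ^ i :: 'a weyl)"
    by (simp add: distrib_right pq flip: mult.assoc)
  also have "\<dots> = weyl_q ^ Suc i * weyl_p + weyl_q * (of_nat i * weyl_q ^ (i - 1)) + weyl_q ^ i"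
    by (simp add: Suc.IH distrib_left mult.assoc)
  also have "weyl_q * (of_nat i * weyl_q ^ (i - 1)) = of_nat i * (weyl_q ^ i :: 'a weyl)"
  proof (cases i)
    case (Suc j)
    have "weyl_q * (of_nat i * weyl_q ^ j) = of_nat i * (weyl_q * weyl_q ^ j :: 'a weyl)"
      by (metis mult.assoc mult_of_nat_commute)
    then show ?thesis by (simp add: Suc)
  qed simp
  finally show ?case by (simp add: algebra_simps)
qed

lemma weyl_scalar_commute: "weyl_scalar c * x = x * weyl_scalar c"
proof (induction x rule: weyl_induct)
  case (scale_one d)
  then show ?case by (simp add: weyl_scale_def mult.commute flip: weyl_scalar_mult)
next
  case (add x y)
  then show ?case by (simp add: algebra_simps)
next
  case (p_mult x)
  have "weyl_scalar c * weyl_p = weyl_p * weyl_scalar c"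
    by transfer (simp add: weyl_cong_def free_gen_def mult_single zero_weyl_word_def weyl_ideal.zero)
  with p_mult show ?case by (metis mult.assoc)
next
  case (q_mult x)
  have "weyl_scalar c * weyl_q = weyl_q * weyl_scalar c"
    by transfer (simp add: weyl_cong_def free_gen_def mult_single zero_weyl_word_def weyl_ideal.zero)
  with q_mult show ?case by (metis mult.assoc)
qed

lemma scale_mult_left: "x * weyl_scale c y = weyl_scale c (x * y)"
  unfolding weyl_scale_def by (metis mult.assoc weyl_scalar_commute)

definition weyl_monomial :: "nat \<times> nat \<Rightarrow> 'k::field weyl"
  where "weyl_monomial = (\<lambda>(i, j). weyl_q ^ i * weyl_p ^ j)"

text \<open>
  Products with all \<open>q\<close> on the left are the convenient ones here, because their diagonals are
  falling factorials.
\<close>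

lemma span_weyl_monomials: "(x :: 'k::field weyl) \<in> weyl.span (range weyl_monomial)"
proof (induction x rule: weyl_induct)
  case (scale_one c)
  have "weyl_monomial (0, 0) \<in> weyl.span (range (weyl_monomial :: _ \<Rightarrow> 'k weyl))"
    by (intro weyl.span_base) simp
  then show ?case by (intro weyl.span_scale) (simp add: weyl_monomial_def)
next
  case (add x y)
  then show ?case by (rule weyl.span_add)
next
  case (p_mult x)
  then show ?case
  proof (induction rule: weyl.span_induct_alt)
    case base
    show ?case by (simp add: weyl.span_zero)
  next
    case (step c x y)
    obtain i j where x: "x = weyl_q ^ i * weyl_p ^ j"
      using step(1) by (auto simp: weyl_monomial_def)
    have "weyl_p * x = weyl_monomial (i, Suc j)
        + weyl_scale (of_nat i) (weyl_monomial (i - 1, j))"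
    proof -
      have "weyl_scalar 0 = (0 :: 'k weyl)"
        using weyl.scale_zero_left[of 1] by (simp add: weyl_scale_def)
      then have "of_nat i = (weyl_scalar (of_nat i) :: 'k weyl)"
        by (induction i) (simp_all add: weyl_scalar_add weyl_scalar_one)
      then show ?thesis
        unfolding x weyl_monomial_def weyl_scale_def
        by (simp only: mult.assoc[symmetric] p_mult_q_power distrib_right) (simp add: mult.assoc)
    qed
    then have x_in: "weyl_p * x \<in> weyl.span (range weyl_monomial)"
      by (simp only:) (intro weyl.span_add weyl.span_scale weyl.span_base rangeI)
    have "weyl_p * (weyl_scale c x + y) = weyl_scale c (weyl_p * x) + weyl_p * y"
      by (simp add: distrib_left scale_mult_left)
    with x_in step(2) show ?case
      by (simp only:) (intro weyl.span_add weyl.span_scale)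
  qed
next
  case (q_mult x)
  then show ?case
  proof (induction rule: weyl.span_induct_alt)
    case base
    show ?case by (simp add: weyl.span_zero)
  next
    case (step c x y)
    obtain i j where x: "x = weyl_q ^ i * weyl_p ^ j"
      using step(1) by (auto simp: weyl_monomial_def)
    have "weyl_q * x = weyl_monomial (Suc i, j)"
      by (simp add: x weyl_monomial_def mult.assoc)
    then have x_in: "weyl_q * x \<in> weyl.span (range weyl_monomial)"
      by (simp only:) (intro weyl.span_base rangeI)
    have "weyl_q * (weyl_scale c x + y) = weyl_scale c (weyl_q * x) + weyl_q * y"
      by (simp add: distrib_left scale_mult_left)
    with x_in step(2) show ?case
      by (simp only:) (intro weyl.span_add weyl.span_scale)
  qed
qed

lemma poly_diag_p_power:
  "poly (diag (weyl_p ^ j) t) x = (if t = - int j then \<Prod>i<j. x - of_nat i else 0)"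
proof (induction j arbitrary: t)
  case 0
  show ?case by (simp add: diag_one)
next
  case (Suc j)
  have "poly (diag (weyl_p ^ Suc j) t) x = (of_int (t + 1) + x) * poly (diag (weyl_p ^ j) (t + 1)) x"
    by (simp only: power_Suc diag_p_mult poly_mult) simp
  also have "\<dots> = (if t = - int (Suc j) then \<Prod>i<Suc j. x - of_nat i else 0)"
  proof (cases "t = - int (Suc j)")
    case True
    then have "of_int (t + 1) + x = x - of_nat j" "t + 1 = - int j" by simp_all
    then show ?thesis using True by (simp only: Suc prod.lessThan_Suc) simp
  next
    case False
    then show ?thesis by (simp add: Suc)
  qed
  finally show ?case .
qed

lemma poly_diag_monomial:
  "poly (diag (weyl_monomial (i, j)) t) x
    = (if t = int i - int j then \<Prod>l<j. x - of_nat l else 0)"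
  by (auto simp: weyl_monomial_def diag_q_power_mult poly_diag_p_power)

text \<open>
  Write \<open>x\<close> as a combination of the \<open>q\<^sup>i p\<^sup>j\<close> and apply it to \<open>q\<^sup>k\<close>. The monomials with \<open>j > k\<close>
  annihilate \<open>q\<^sup>k\<close>, those with \<open>j < k\<close> have coefficient \<open>0\<close> by induction on \<open>k\<close>, and the remaining ones
  yield the distinct powers \<open>q\<^sup>i\<close> with the factor \<open>k!\<close>, which is invertible in characteristic \<open>0\<close>.
\<close>

lemma diag_eq_zeroD:
  fixes x :: "'k::field_char_0 weyl"
  assumes "\<And>t. diag x t = 0"
  shows "x = 0"
proof -
  obtain T r where T: "finite T" "T \<subseteq> range weyl_monomial" and x: "x = (\<Sum>a\<in>T. weyl_scale (r a) a)"
    using span_weyl_monomials[of x] unfolding weyl.span_explicit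
    by (elim CollectE exE conjE that)
  obtain F where F: "inj_on (weyl_monomial :: _ \<Rightarrow> 'k weyl) F" "T = weyl_monomial ` F"
    using subset_image_inj[THEN iffD1, OF T(2)] by auto
  define c where "c m = r (weyl_monomial m)" for m
  have "finite F" using T(1) F finite_image_iff by blast
  have x: "x = (\<Sum>m\<in>F. weyl_scale (c m) (weyl_monomial m))"
    using F by (simp add: x c_def sum.reindex)
  have "c m = 0" if "m \<in> F" for m
    using that
  proof (induction m rule: measure_induct_rule[of snd])
    case (less m)
    obtain i k where m: "m = (i, k)" by (cases m)
    have "poly (diag (weyl_scale (c m') (weyl_monomial m')) (int i - int k)) (of_nat k) = 0"
      if "m' \<in> F" "m' \<noteq> m" for m'
    proof -
      obtain i' j where m': "m' = (i', j)" by (cases m')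
      consider "j < k" | "j = k" | "j > k" by linarith
      then show ?thesis
      proof cases
        case 1
        then show ?thesis using less that by (simp add: m m' diag_zero)
      next
        case 2
        then show ?thesis using that by (auto simp: m m' diag_scale poly_diag_monomial)
      next
        case 3
        then have "(\<Prod>l<j. of_nat k - of_nat l :: 'k) = 0" by (auto simp: prod_zero_iff)
        then show ?thesis by (simp add: m' diag_scale poly_diag_monomial)
      qed
    qed
    then have "poly (diag x (int i - int k)) (of_nat k)
        = poly (diag (weyl_scale (c m) (weyl_monomial m)) (int i - int k)) (of_nat k)"
      unfolding x diag_add poly_add diag_sum poly_sum sum.remove[OF \<open>finite F\<close> less.prems] by simp
    also have "\<dots> = c m * (\<Prod>l<k. of_nat k - of_nat l)"
      by (simp add: m diag_scale poly_diag_monomial)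
    finally show ?case
      using assms by (auto simp: prod_zero_iff)
  qed
  then show ?thesis by (simp add: x)
qed

lemma weyl_eqI:
  fixes x y :: "'k::field_char_0 weyl"
  assumes "\<And>t. diag x t = diag y t"
  shows "x = y"
  using diag_eq_zeroD[of "x - y"] assms by (simp add: diag_diff)

section \<open>The two ends of the Newton polygon\<close>

lemma diag_bracket_0_right [simp]: "diag_bracket a b P 0 = 0"
  and diag_bracket_0_left [simp]: "diag_bracket a b 0 Q = 0"
  by (simp_all add: diag_bracket_def)

lemma diag_bracket_const: "degree P = 0 \<Longrightarrow> diag_bracket 0 b P Q = 0"
  by (auto elim!: degree_eq_zeroE simp: diag_bracket_def pcompose_idR)

text \<open>
  Let \<open>b\<close> be the least index of a diagonal of \<open>w\<close>. Every step compares the component of lowest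
  index in \<open>[z, w] = 1\<close> with a bracket whose leading coefficient cannot vanish.
\<close>

lemma lowest_diagonals:
  fixes z w :: "'k::field_char_0 weyl"
  assumes comm: "commutator z w = 1" and nonneg: "\<And>a. a < 0 \<Longrightarrow> diag z a = 0"
  shows "degree (diag z 0) = 0" (is ?z0)
    and "diag z 1 \<noteq> 0 \<and> degree (diag z 1) = 0" (is ?z1)
    and "degree (diag w (- 1)) = 1" (is ?w1)
    and "\<And>b. b < - 1 \<Longrightarrow> diag w b = 0"
proof -
  define b where "b = Min {b. diag w b \<noteq> 0}"
  have "w \<noteq> 0" using comm by (auto simp: commutator_def)
  then have "{b. diag w b \<noteq> 0} \<noteq> {}" using diag_eq_zeroD by auto
  then have wb: "diag w b \<noteq> 0"
    using Min_in[OF finite_diag] unfolding b_def by blast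
  have w_below: "diag w b' = 0" if "b' < b" for b'
    using that Min_le[OF finite_diag, of b' w] unfolding b_def by force
  have b: "b < 0"
  proof (rule ccontr)
    assume b: "\<not> b < 0"
    have "coeff (diag (commutator z w) 0) 0
        = coeff (diag_bracket 0 (0 - 0) (diag z 0) (diag w (0 - 0))) 0"
    proof (rule coeff_diag_commutator)
      fix a :: int assume "a \<noteq> 0"
      with b show "coeff (diag_bracket a (0 - a) (diag z a) (diag w (0 - a))) 0 = 0"
        using nonneg[of a] w_below[of "- a"] by (cases "a < 0") auto
    qed
    then show False
      by (simp add: comm diag_one diag_bracket_def pcompose_idR)
  qed
  define e where "e = degree (diag w b)"
  have e: "- b \<le> int e" using diag_negative_degree[OF b wb] by (simp add: e_def)
  \<comment> \<open>If \<open>z\<^sub>0\<close> had degree \<open>d > 0\<close>, diagonal \<open>b\<close> of \<open>[z, w]\<close> would have leading factor \<open>b d \<noteq> 0\<close>.\<close>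
  show z0: ?z0
  proof (rule ccontr)
    define d where "d = degree (diag z 0)"
    assume "degree (diag z 0) \<noteq> 0"
    then have d: "d > 0" by (simp add: d_def)
    have "coeff (diag (commutator z w) b) (d + e - 1)
        = coeff (diag_bracket 0 (b - 0) (diag z 0) (diag w (b - 0))) (d + e - 1)"
    proof (rule coeff_diag_commutator)
      fix a :: int assume "a \<noteq> 0"
      then show "coeff (diag_bracket a (b - a) (diag z a) (diag w (b - a))) (d + e - 1) = 0"
        using nonneg[of a] w_below[of "b - a"] by (cases "a < 0") auto
    qed
    also have "\<dots> = of_int (b * int d) * coeff (diag z 0) d * coeff (diag w b) e"
      using d by (subst coeff_diag_bracket[of _ d _ e]) (auto simp: d_def e_def)
    finally show False
      using b d wb by (auto simp: comm diag_one d_def e_def)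
  qed
  define a where "a = Min {a. a > 0 \<and> diag z a \<noteq> 0}"
  have fin: "finite {a. a > 0 \<and> diag z a \<noteq> 0}"
    by (rule finite_subset[OF _ finite_diag[of z]]) auto
  \<comment> \<open>Otherwise \<open>z\<close> would be a scalar and commute with \<open>w\<close>.\<close>
  have "{a. a > 0 \<and> diag z a \<noteq> 0} \<noteq> {}"
  proof
    assume "{a. a > 0 \<and> diag z a \<noteq> 0} = {}"
    then have "diag z a = 0" if "a \<noteq> 0" for a
      using that nonneg[of a] by (cases "a < 0") auto
    then have "coeff (diag (commutator z w) 0) 0
        = coeff (diag_bracket 0 (0 - 0) (diag z 0) (diag w (0 - 0))) 0"
      by (intro coeff_diag_commutator) simp
    then show False by (simp add: comm diag_one diag_bracket_const z0)
  qed
  then have a: "a > 0" and za: "diag z a \<noteq> 0"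
    using Min_in[OF fin] unfolding a_def by auto
  have z_below: "diag z a' = 0" if "0 < a'" "a' < a" for a'
    using that Min_le[OF fin, of a'] unfolding a_def by force
  \<comment> \<open>Since \<open>z\<^sub>0\<close> is a scalar, diagonal \<open>a + b\<close> of \<open>[z, w]\<close> comes from the pair \<open>(a, b)\<close> alone.\<close>
  define d where "d = degree (diag z a)"
  have "coeff (diag (commutator z w) (a + b)) (d + e - 1)
      = coeff (diag_bracket a (a + b - a) (diag z a) (diag w (a + b - a))) (d + e - 1)"
  proof (rule coeff_diag_commutator)
    fix a' :: int assume "a' \<noteq> a"
    then consider "a' < 0" | "a' = 0" | "0 < a'" "a' < a" | "a' > a" by linarith
    then show "coeff (diag_bracket a' (a + b - a') (diag z a') (diag w (a + b - a'))) (d + e - 1) = 0"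
      using nonneg z_below w_below z0 by cases (auto simp: diag_bracket_const)
  qed
  also have "\<dots> = of_int (b * int d - a * int e) * coeff (diag z a) d * coeff (diag w b) e"
    using b e by (subst coeff_diag_bracket[of _ d _ e]) (auto simp: d_def e_def)
  also have "\<dots> \<noteq> 0"
  proof -
    have "b * int d \<le> 0" "a * int e > 0"
      using a b e by (auto simp: mult_nonpos_nonneg)
    then have "of_int (b * int d - a * int e) \<noteq> (0 :: 'k)"
      unfolding of_int_eq_0_iff by linarith
    then show ?thesis using za wb by (simp add: d_def e_def)
  qed
  finally have "a + b = 0" "d + e - 1 = 0"
    by (auto simp: comm diag_one split: if_splits)
  then have "a = 1" "b = - 1" "d = 0" "e = 1" using a b e by linarith+
  then show ?z1 ?w1 "\<And>b. b < - 1 \<Longrightarrow> diag w b = 0"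
    using za w_below by (auto simp: d_def e_def)
qed

text \<open>
  With \<open>(1, 0)\<close> and \<open>(-1, 1)\<close> as the left ends of the two Newton polygons, let \<open>\<nu>\<close> be the largest slope
  of a segment from these ends to another point, or \<open>0\<close> if that is larger. The rightmost points
  on the supporting lines of slope \<open>\<nu>\<close> form the only pair that contributes to the extreme
  coefficient of \<open>[z, w]\<close> in diagonal \<open>a + b\<close>.
\<close>

lemma higher_diagonals_vanish:
  fixes z w :: "'k::field_char_0 weyl"
  assumes comm: "commutator z w = 1" and nonneg: "\<And>a. a < 0 \<Longrightarrow> diag z a = 0"
    and "a \<ge> 2"
  shows "diag z a = 0"
proof (rule ccontr)
  assume "diag z a \<noteq> 0"
  note z0 = lowest_diagonals(1)[OF comm nonneg] and z1 = lowest_diagonals(2)[OF comm nonneg]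
    and w1 = lowest_diagonals(3)[OF comm nonneg] and w_below = lowest_diagonals(4)[OF comm nonneg]
  define d where "d a = degree (diag z a)" for a
  define e where "e b = degree (diag w b)" for b
  define A where "A = {a. a \<ge> 2 \<and> diag z a \<noteq> 0}"
  define B where "B = {b. b \<ge> 0 \<and> diag w b \<noteq> 0}"
  define slopes :: "rat set" where "slopes = insert 0
    ((\<lambda>a. of_nat (d a) / of_int (a - 1)) ` A \<union> (\<lambda>b. (of_nat (e b) - 1) / of_int (b + 1)) ` B)"
  define \<nu> where "\<nu> = Max slopes"
  have "finite A" "finite B"
    unfolding A_def B_def
    by (rule finite_subset[OF _ finite_diag[of z]] finite_subset[OF _ finite_diag[of w]]; auto)+
  then have fin: "finite slopes" by (simp add: slopes_def)
  have \<nu>_nonneg: "\<nu> \<ge> 0" unfolding \<nu>_def by (rule Max_ge[OF fin]) (simp add: slopes_def)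
  have \<nu>_in: "\<nu> \<in> slopes" unfolding \<nu>_def by (rule Max_in[OF fin]) (simp add: slopes_def)
  have d_le: "of_nat (d a) \<le> \<nu> * of_int (a - 1)" if "a \<ge> 1" "diag z a \<noteq> 0" for a
  proof (cases "a = 1")
    case True
    then show ?thesis using z1 by (simp add: d_def)
  next
    case False
    then have "of_nat (d a) / of_int (a - 1) \<le> \<nu>"
      using that unfolding \<nu>_def by (intro Max_ge[OF fin]) (auto simp: slopes_def A_def)
    moreover have "(of_int (a - 1) :: rat) > 0" using that False by simp
    ultimately show ?thesis by (simp only: pos_divide_le_eq)
  qed
  have e_le: "of_nat (e b) - 1 \<le> \<nu> * of_int (b + 1)" if "b \<ge> - 1" "diag w b \<noteq> 0" for b
  proof (cases "b = - 1")
    case True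
    then show ?thesis using w1 by (simp add: e_def)
  next
    case False
    then have "(of_nat (e b) - 1) / of_int (b + 1) \<le> \<nu>"
      using that unfolding \<nu>_def by (intro Max_ge[OF fin]) (auto simp: slopes_def B_def)
    moreover have "(of_int (b + 1) :: rat) > 0" using that False by simp
    ultimately show ?thesis by (simp only: pos_divide_le_eq)
  qed
  \<comment> \<open>The points on the supporting lines; the left ends belong to them.\<close>
  define A' where "A' = {a. a \<ge> 1 \<and> diag z a \<noteq> 0 \<and> of_nat (d a) = \<nu> * of_int (a - 1)}"
  define B' where "B' = {b. b \<ge> - 1 \<and> diag w b \<noteq> 0 \<and> of_nat (e b) - 1 = \<nu> * of_int (b + 1)}"
  have fin': "finite A'" "finite B'"
    unfolding A'_def B'_def
    by (rule finite_subset[OF _ finite_diag[of z]] finite_subset[OF _ finite_diag[of w]]; auto)+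
  have mem: "1 \<in> A'" "- 1 \<in> B'"
    using z1 w1 by (auto simp: A'_def B'_def d_def e_def)
  define a1 where "a1 = Max A'"
  define b1 where "b1 = Max B'"
  have a1: "a1 \<in> A'" "\<And>a. a \<in> A' \<Longrightarrow> a \<le> a1" and b1: "b1 \<in> B'" "\<And>b. b \<in> B' \<Longrightarrow> b \<le> b1"
    using mem fin' by (auto simp: a1_def b1_def intro: Max_in)
  have ge: "a1 \<ge> 1" "b1 \<ge> - 1" using a1(2) b1(2) mem by auto
  have d1: "of_nat (d a1) = \<nu> * of_int (a1 - 1)" and e1: "of_nat (e b1) = 1 + \<nu> * of_int (b1 + 1)"
    using a1(1) b1(1) by (auto simp: A'_def B'_def algebra_simps)
  have pos: "a1 + b1 > 0"
  proof -
    consider "\<nu> = 0" | a where "a \<in> A" "\<nu> = of_nat (d a) / of_int (a - 1)"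
      | b where "b \<in> B" "\<nu> = (of_nat (e b) - 1) / of_int (b + 1)"
      using \<nu>_in by (auto simp: slopes_def)
    then show ?thesis
    proof cases
      \<comment> \<open>For \<open>\<nu> = 0\<close> the assumed diagonal \<open>z\<^sub>a\<close> itself is a constant and lies on the line.\<close>
      case 1
      have "a \<in> A'"
        using d_le[of a] \<open>a \<ge> 2\<close> \<open>diag z a \<noteq> 0\<close> by (simp add: A'_def 1)
      with a1(2) ge \<open>a \<ge> 2\<close> show ?thesis by force
    next
      case (2 a)
      then have "a \<in> A'" by (auto simp: A_def A'_def)
      with a1(2) ge 2 show ?thesis by (force simp: A_def)
    next
      case (3 b)
      have "(of_int (b + 1) :: rat) \<noteq> 0" using 3(1) unfolding B_def of_int_eq_0_iff by auto
      then have "b \<in> B'" using 3 by (auto simp: B_def B'_def)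
      with b1(2) ge 3 show ?thesis by (force simp: B_def)
    qed
  qed
  have "(of_nat (e b1) :: rat) \<ge> 1" using e1 \<nu>_nonneg ge by simp
  then have e1_pos: "e b1 \<ge> 1" by simp
  define n where "n = d a1 + e b1 - 1"
  have n: "Suc n = d a1 + e b1" using e1_pos by (simp add: n_def)
  have n_eq: "(of_nat (Suc n) :: rat) = 1 + \<nu> * of_int (a1 + b1)"
    unfolding n of_nat_add d1 e1 by (simp add: algebra_simps)
  have "coeff (diag (commutator z w) (a1 + b1)) n
      = coeff (diag_bracket a1 (a1 + b1 - a1) (diag z a1) (diag w (a1 + b1 - a1))) n"
  proof (rule coeff_diag_commutator)
    fix a :: int assume "a \<noteq> a1"
    define b where "b = a1 + b1 - a"
    consider "diag z a = 0 \<or> diag w b = 0" | "a = 0"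
      | "a \<ge> 1" "b \<ge> - 1" "diag z a \<noteq> 0" "diag w b \<noteq> 0"
      using nonneg[of a] w_below[of b] by linarith
    then have "coeff (diag_bracket a b (diag z a) (diag w b)) n = 0"
    proof cases
      case 3
      have "of_nat (d a + e b) \<le> (of_nat (Suc n) :: rat)"
        using d_le[OF 3(1,3)] e_le[OF 3(2,4)] unfolding n_eq by (simp add: b_def algebra_simps)
      then have le: "d a + e b \<le> Suc n" by (simp only: of_nat_le_iff)
      have "d a + e b \<noteq> Suc n"
      proof
        assume "d a + e b = Suc n"
        then have "of_nat (d a) + of_nat (e b) = 1 + \<nu> * of_int (a1 + b1)"
          unfolding n_eq[symmetric] by (metis of_nat_add)
        also have "\<dots> = \<nu> * of_int (a - 1) + \<nu> * of_int (b + 1) + 1"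
          by (simp add: b_def algebra_simps)
        finally have "of_nat (d a) = \<nu> * of_int (a - 1)" "of_nat (e b) - 1 = \<nu> * of_int (b + 1)"
          using d_le[OF 3(1,3)] e_le[OF 3(2,4)] by linarith+
        then have "a \<in> A'" "b \<in> B'" using 3 by (auto simp: A'_def B'_def)
        then show False using a1(2) b1(2) \<open>a \<noteq> a1\<close> by (force simp: b_def)
      qed
      \<comment> \<open>Raise the bound for the degree of \<open>w\<^sub>b\<close> until the bounds add up to \<open>n + 1\<close>.\<close>
      with le have "coeff (diag w b) (Suc n - d a) = 0"
        by (intro coeff_eq_0) (simp add: e_def)
      then show ?thesis
        using le by (subst coeff_diag_bracket[of _ "d a" _ "Suc n - d a"]) (auto simp: d_def e_def)
    qed (auto simp: z0 diag_bracket_const)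
    then show "coeff (diag_bracket a (a1 + b1 - a) (diag z a) (diag w (a1 + b1 - a))) n = 0"
      by (simp add: b_def)
  qed
  also have "\<dots> = of_int (b1 * int (d a1) - a1 * int (e b1))
      * coeff (diag z a1) (d a1) * coeff (diag w b1) (e b1)"
    using n by (subst coeff_diag_bracket[of _ "d a1" _ "e b1"]) (auto simp: d_def e_def)
  also have "\<dots> \<noteq> 0"
  proof -
    have "(of_int (b1 * int (d a1) - a1 * int (e b1)) :: rat)
        = of_int b1 * of_nat (d a1) - of_int a1 * of_nat (e b1)"
      by simp
    \<comment> \<open>The equations of the supporting lines make the quadratic terms cancel.\<close>
    also have "\<dots> = - (\<nu> * of_int (a1 + b1) + of_int a1)"
      unfolding d1 e1 by (simp add: algebra_simps)
    also have "\<dots> < 0"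
    proof -
      have "0 \<le> \<nu> * of_int (a1 + b1)" "(0 :: rat) < of_int a1"
        using \<nu>_nonneg pos ge by (auto intro: mult_nonneg_nonneg simp del: of_int_add)
      then show ?thesis by linarith
    qed
    finally have "b1 * int (d a1) - a1 * int (e b1) \<noteq> 0"
      by (metis of_int_0 less_irrefl)
    then have "of_int (b1 * int (d a1) - a1 * int (e b1)) \<noteq> (0 :: 'k)"
      by (simp only: of_int_eq_0_iff not_False_eq_True)
    then show ?thesis using a1(1) b1(1) by (simp add: A'_def B'_def d_def e_def)
  qed
  finally show False using pos by (simp add: comm diag_one)
qed

section \<open>The pair is triangular and generates\<close>

text \<open>
  Once \<open>z\<close> is \<open>\<alpha> q\<close> up to a scalar, the diagonals of \<open>[z, w]\<close> are \<open>-\<alpha>\<close> times first differences of the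
  diagonals of \<open>w\<close>; in characteristic \<open>0\<close> only constants have difference \<open>0\<close>.
\<close>

lemma nonneg_pair_form:
  fixes z w :: "'k::field_char_0 weyl"
  assumes comm: "commutator z w = 1" and nonneg: "\<And>a. a < 0 \<Longrightarrow> diag z a = 0"
  obtains \<alpha> \<beta> \<gamma> \<omega> F where "\<alpha> \<noteq> 0" "\<beta> \<noteq> 0"
    "z = weyl_scale \<gamma> 1 + weyl_scale \<alpha> weyl_q"
    "w = weyl_scale \<beta> weyl_p + (\<Sum>b\<in>F. weyl_scale (\<omega> b) (weyl_q ^ b))"
proof -
  note z0 = lowest_diagonals(1)[OF comm nonneg] and z1 = lowest_diagonals(2)[OF comm nonneg]
    and w1 = lowest_diagonals(3)[OF comm nonneg] and w_below = lowest_diagonals(4)[OF comm nonneg]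
    and z_above = higher_diagonals_vanish[OF comm nonneg]
  obtain \<alpha> where \<alpha>: "diag z 1 = [:\<alpha>:]" "\<alpha> \<noteq> 0"
    using z1 by (metis degree_eq_zeroE pCons_0_0)
  obtain \<gamma> where \<gamma>: "diag z 0 = [:\<gamma>:]" using z0 degree_eq_zeroE by blast
  obtain \<beta> \<beta>' where "diag w (- 1) = [:\<beta>', \<beta>:]" "\<beta> \<noteq> 0"
    using degree1_coeffs[OF w1] by metis
  \<comment> \<open>The constant \<open>1\<close> is mapped into the polynomials, which removes the constant term.\<close>
  moreover have "poly (diag w (- 1)) (of_nat 0) = 0" by (rule diag_root) simp
  ultimately have \<beta>: "diag w (- 1) = [:0, \<beta>:]" "\<beta> \<noteq> 0" by auto
  have w_const: "degree (diag w b) = 0" if "b \<ge> 0" for b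
  proof (rule ccontr)
    define e where "e = degree (diag w b)"
    assume "degree (diag w b) \<noteq> 0"
    then have e: "e > 0" by (simp add: e_def)
    have "coeff (diag (commutator z w) (b + 1)) (e - 1)
        = coeff (diag_bracket 1 (b + 1 - 1) (diag z 1) (diag w (b + 1 - 1))) (e - 1)"
    proof (rule coeff_diag_commutator)
      fix a :: int assume "a \<noteq> 1"
      then consider "a < 0" | "a = 0" | "a \<ge> 2" by linarith
      then show "coeff (diag_bracket a (b + 1 - a) (diag z a) (diag w (b + 1 - a))) (e - 1) = 0"
        by cases (auto simp: nonneg z_above diag_bracket_const z0)
    qed
    also have "\<dots> = - of_nat e * \<alpha> * coeff (diag w b) e"
      using e by (subst coeff_diag_bracket[of _ 0 _ e]) (auto simp: e_def \<alpha>)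
    finally show False using e that \<alpha> by (auto simp: comm diag_one e_def)
  qed
  define F where "F = {b. diag w (int b) \<noteq> 0}"
  define \<omega> where "\<omega> b = coeff (diag w (int b)) 0" for b
  have F: "finite F"
    using finite_vimageI[OF finite_diag[of w] inj_of_nat] by (simp add: F_def vimage_def)
  have w_nonneg: "diag w (int b) = [:\<omega> b:]" for b
    using w_const[of "int b"] by (auto elim!: degree_eq_zeroE simp: \<omega>_def)
  have z: "z = weyl_scale \<gamma> 1 + weyl_scale \<alpha> weyl_q"
  proof (rule weyl_eqI)
    fix t :: int
    consider "t < 0" | "t = 0" | "t = 1" | "t \<ge> 2" by linarith
    then show "diag z t = diag (weyl_scale \<gamma> 1 + weyl_scale \<alpha> weyl_q) t"
      using diag_q_power[of 1 t]
      by cases (auto simp: diag_add diag_scale diag_one nonneg z_above \<alpha> \<gamma> one_pCons)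
  qed
  have w: "w = weyl_scale \<beta> weyl_p + (\<Sum>b\<in>F. weyl_scale (\<omega> b) (weyl_q ^ b))"
  proof (rule weyl_eqI)
    fix t :: int
    have "(\<Sum>b\<in>F. smult (\<omega> b) (diag (weyl_q ^ b) t)) = (if t \<ge> 0 then diag w t else 0)"
    proof (cases "t \<ge> 0")
      case True
      then obtain b where b: "t = int b" using nonneg_int_cases by blast
      have "(\<Sum>b'\<in>F. smult (\<omega> b') (diag (weyl_q ^ b') t)) = (\<Sum>b'\<in>F. if b' = b then [:\<omega> b:] else 0)"
        by (intro sum.cong) (auto simp: diag_q_power b one_pCons)
      then show ?thesis using F by (auto simp: b w_nonneg F_def)
    next
      case False
      then show ?thesis by (auto simp: diag_q_power intro!: sum.neutral)
    qed
    moreover consider "t < - 1" | "t = - 1" | "t \<ge> 0" by linarith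
    then show "diag w t = diag (weyl_scale \<beta> weyl_p + (\<Sum>b\<in>F. weyl_scale (\<omega> b) (weyl_q ^ b))) t"
      using calculation by cases (auto simp: diag_add diag_scale diag_sum diag_p w_below \<beta>)
  qed
  show ?thesis by (rule that[OF \<open>\<alpha> \<noteq> 0\<close> \<open>\<beta> \<noteq> 0\<close> z w])
qed

lemma weyl_subalgebra_eq_UNIV:
  assumes "weyl_subalgebra B" "weyl_p \<in> B" "weyl_q \<in> B"
  shows "B = UNIV"
proof -
  have "x \<in> B" for x
    using assms unfolding weyl_subalgebra_def
    by (induction x rule: weyl_induct)
      (auto intro: weyl.subspace_add weyl.subspace_scale)
  then show ?thesis by blast
qed

lemma nonneg_pair_generates:
  fixes z w :: "'k::field_char_0 weyl"
  assumes "commutator z w = 1" "z \<in> weyl_D_nonneg"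
    and B: "weyl_subalgebra B" "z \<in> B" "w \<in> B"
  shows "B = UNIV"
proof -
  obtain \<alpha> \<beta> \<gamma> \<omega> F where nz: "\<alpha> \<noteq> 0" "\<beta> \<noteq> 0"
    and z: "z = weyl_scale \<gamma> 1 + weyl_scale \<alpha> weyl_q"
    and w: "w = weyl_scale \<beta> weyl_p + (\<Sum>b\<in>F. weyl_scale (\<omega> b) (weyl_q ^ b))"
    using nonneg_pair_form[OF assms(1) diag_nonneg[OF assms(2)]] by blast
  have sub: "weyl.subspace B" and one: "1 \<in> B" and mult: "\<And>x y. x \<in> B \<Longrightarrow> y \<in> B \<Longrightarrow> x * y \<in> B"
    using B(1) by (auto simp: weyl_subalgebra_def)
  have "weyl_q = weyl_scale (1 / \<alpha>) (z - weyl_scale \<gamma> 1)" using nz by (simp add: z)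
  also have "\<dots> \<in> B"
    using B one by (intro weyl.subspace_scale[OF sub] weyl.subspace_diff[OF sub])
  finally have q: "weyl_q \<in> B" .
  have "weyl_q ^ b \<in> B" for b by (induction b) (auto simp: one q mult)
  then have sum: "(\<Sum>b\<in>F. weyl_scale (\<omega> b) (weyl_q ^ b)) \<in> B"
    by (intro weyl.subspace_sum[OF sub] weyl.subspace_scale[OF sub])
  have "weyl_p = weyl_scale (1 / \<beta>) (w - (\<Sum>b\<in>F. weyl_scale (\<omega> b) (weyl_q ^ b)))"
    using nz by (simp add: w)
  also have "\<dots> \<in> B"
    using B sum by (intro weyl.subspace_scale[OF sub] weyl.subspace_diff[OF sub])
  finally have "weyl_p \<in> B" .
  with q B(1) show ?thesis by (intro weyl_subalgebra_eq_UNIV)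
qed

theorem theorem1p1:
  fixes z w :: "'k::field_char_0 weyl"
  assumes "commutator z w = 1"
    and "z \<in> weyl_D_nonneg \<or> w \<in> weyl_D_nonneg"
  shows "weyl_subalgebra hull {z, w} = UNIV"
proof -
  have "B = UNIV" if B: "weyl_subalgebra B" "z \<in> B" "w \<in> B" for B
  proof (cases "z \<in> weyl_D_nonneg")
    case True
    with assms(1) B show ?thesis by (intro nonneg_pair_generates)
  next
    case False
    have "commutator w (- z) = 1" using assms(1) by (simp add: commutator_def)
    moreover have "w \<in> weyl_D_nonneg" using False assms(2) by blast
    moreover have "- z \<in> B"
      using B weyl.subspace_neg by (auto simp: weyl_subalgebra_def)
    ultimately show ?thesis using B by (intro nonneg_pair_generates)
  qed
  then show ?thesis unfolding hull_def by blast
qed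

end
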